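(* Let $k\ge 2$ be an integer. For every finite group $G$ and every non-doubling set $X\subset G$ of size $|X|>1$ there is a set $U\subset G$ which is $k$-universal for $X$ and satisfies $$|U|\le 36\,|X|^{1-1/k}(\log |X|)^{1/k}.$$ In particular, for every finite group $G$ there is a $k$-universal set $U\subset G$ of size $$|U|\le 36\,|G|^{1-1/k}(\log |G|)^{1/k}.$$
   Context: Groups may be non-abelian. $\log$ is the natural logarithm. For $X\subset G$ write $XX=\{xx' : x,x'\in X\}$; a set $X\subset G$ is non-doubling if $|XX|\le 3|X|$. A set $U\subset G$ is $k$-universal for $X\subset G$ if for every $k$-element set $W=\{w_1,\dots,w_k\}\subset X$ (with $|W|=k$) there is $g\in G$ such that $gW=\{gw_1,\dots,gw_k\}\subset U$. A set $U\subset G$ is $k$-universal if it is $k$-universal for $X=G$. *)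

theory Defs
  imports Complex_Main "HOL-Algebra.Coset"
begin

definition non_doubling :: "('a, 'b) monoid_scheme \<Rightarrow> 'a set \<Rightarrow> bool" where
  "non_doubling G X \<longleftrightarrow> card (X <#>\<^bsub>G\<^esub> X) \<le> 3 * card X"

definition universal_for :: "('a, 'b) monoid_scheme \<Rightarrow> nat \<Rightarrow> 'a set \<Rightarrow> 'a set \<Rightarrow> bool" where
  "universal_for G k X U \<longleftrightarrow>
    (\<forall>W. W \<subseteq> X \<and> finite W \<and> card W = k \<longrightarrow> (\<exists>g \<in> carrier G. g <#\<^bsub>G\<^esub> W \<subseteq> U))"

definition universal :: "('a, 'b) monoid_scheme \<Rightarrow> nat \<Rightarrow> 'a set \<Rightarrow> bool" where
  "universal G k U \<longleftrightarrow> universal_for G k (carrier G) U"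

end

theory Submission
  imports Defs "HOL-Library.Disjoint_Sets"
begin

text \<open>
  Write \<open>n\<close> for the size of \<open>X\<close> and choose a random subset \<open>U\<close> of \<open>X X\<close> by keeping every point
  independently with probability \<open>p\<close>, where \<open>p ^ k = 2 k\<^sup>3 ln n / n\<close>. A \<open>k\<close>-set \<open>W\<close> in \<open>X\<close> has
  \<open>n\<close> translates \<open>g W\<close> with \<open>g\<close> in \<open>X\<close>, all of them inside \<open>X X\<close>. Two of them, for \<open>g\<close> and \<open>h\<close>,
  meet only if \<open>h\<close> has the form \<open>g a b\<inverse>\<close> with \<open>a\<close>, \<open>b\<close> in \<open>W\<close>, so some \<open>n / k\<^sup>2\<close> of the translates are
  pairwise disjoint (\<open>ex_many_disjoint_translates\<close>). Each of these is contained in \<open>U\<close> with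
  probability \<open>p ^ k\<close>, independently, so \<open>U\<close> contains none of them with probability at most
  \<open>exp (- p ^ k n / k\<^sup>2) = n powr (- 2 k)\<close>. This beats the at most \<open>n ^ k\<close> choices of \<open>W\<close>, while the
  expected size of \<open>U\<close> is at most \<open>3 n p\<close>, and \<open>p\<close> is at most \<open>4 (ln n / n) powr (1 / k)\<close>
  because \<open>2 k\<^sup>3 \<le> 4 ^ k\<close>. Markov's inequality at \<open>9 n p\<close> costs only probability \<open>1/3\<close>, whence
  the constant \<open>36 = 9 * 4\<close>.

  The probabilistic argument needs no probability space. The expected number of failing sets \<open>W\<close>
  plus the normalised expected size of \<open>U\<close> is the value at the constant point \<open>p\<close> of a function on
  the cube \<open>[0,1] ^ (X X)\<close> that is affine in each coordinate separately, and such a function is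
  nowhere smaller than at the best vertex (\<open>multiaffine_vertex_le\<close>). The best vertex is the
  indicator function of the required set (\<open>ex_small_transversal_set\<close>).
\<close>

section \<open>Functions affine in each coordinate\<close>

definition multiaffine_on :: "'a set \<Rightarrow> (('a \<Rightarrow> real) \<Rightarrow> real) \<Rightarrow> bool" where
  "multiaffine_on Y F \<longleftrightarrow>
    (\<forall>y\<in>Y. \<forall>u t. F (u(y := t)) = (1 - t) * F (u(y := 0)) + t * F (u(y := 1)))"

lemma multiaffine_on_add:
  assumes "multiaffine_on Y F" and "multiaffine_on Y H"
  shows "multiaffine_on Y (\<lambda>u. F u + H u)"
  unfolding multiaffine_on_def
proof (intro ballI allI)
  fix y u t assume y: "y \<in> Y"
  have "F (u(y := t)) = (1 - t) * F (u(y := 0)) + t * F (u(y := 1))"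
    using assms(1) y unfolding multiaffine_on_def by blast
  moreover have "H (u(y := t)) = (1 - t) * H (u(y := 0)) + t * H (u(y := 1))"
    using assms(2) y unfolding multiaffine_on_def by blast
  ultimately show "F (u(y := t)) + H (u(y := t)) =
      (1 - t) * (F (u(y := 0)) + H (u(y := 0))) + t * (F (u(y := 1)) + H (u(y := 1)))"
    by (simp add: algebra_simps)
qed

lemma multiaffine_on_divide:
  assumes "multiaffine_on Y F"
  shows "multiaffine_on Y (\<lambda>u. F u / c)"
  unfolding multiaffine_on_def
proof (intro ballI allI)
  fix y u t assume y: "y \<in> Y"
  have "F (u(y := t)) = (1 - t) * F (u(y := 0)) + t * F (u(y := 1))"
    using assms y unfolding multiaffine_on_def by blast
  then show "F (u(y := t)) / c = (1 - t) * (F (u(y := 0)) / c) + t * (F (u(y := 1)) / c)"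
    by (simp add: add_divide_distrib)
qed

lemma multiaffine_on_sum:
  assumes "finite I" and "\<And>i. i \<in> I \<Longrightarrow> multiaffine_on Y (F i)"
  shows "multiaffine_on Y (\<lambda>u. \<Sum>i\<in>I. F i u)"
  using assms
proof (induction I rule: finite_induct)
  case empty
  then show ?case by (simp add: multiaffine_on_def)
next
  case (insert i I)
  then show ?case by (simp add: multiaffine_on_add)
qed

lemma multiaffine_on_coordinate: "multiaffine_on Y (\<lambda>u. u x)"
  by (simp add: multiaffine_on_def left_diff_distrib)

text \<open>Disjointness makes every coordinate occur in at most one factor. At a 0-1 point the product
  is 1 or 0 according to whether or not the set of ones contains none of the \<open>E j\<close>.\<close>
lemma multiaffine_on_avoidance:
  fixes E :: "'j \<Rightarrow> 'a set"
  assumes J: "finite J" and fin: "\<And>j. j \<in> J \<Longrightarrow> finite (E j)"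
    and disj: "disjoint_family_on E J"
  shows "multiaffine_on Y (\<lambda>u. \<Prod>j\<in>J. 1 - (\<Prod>y\<in>E j. u y))"
  unfolding multiaffine_on_def
proof (intro ballI allI)
  fix y and u :: "'a \<Rightarrow> real" and t :: real
  let ?f = "\<lambda>u j. 1 - (\<Prod>y\<in>E j. u y) :: real"
  have same: "?f (u(y := s)) j = ?f u j" if "y \<notin> E j" for s j
    using that by (auto intro!: prod.cong)
  show "prod (?f (u(y := t))) J
      = (1 - t) * prod (?f (u(y := 0))) J + t * prod (?f (u(y := 1))) J"
  proof (cases "\<exists>j\<in>J. y \<in> E j")
    case False
    then have "prod (?f (u(y := s))) J = prod (?f u) J" for s
      using same by (intro prod.cong) auto
    then show ?thesis by (simp only:) (simp add: algebra_simps)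
  next
    case True
    then obtain j where j: "j \<in> J" "y \<in> E j" by blast
    have others: "y \<notin> E i" if "i \<in> J - {j}" for i
      using disj j that by (auto simp: disjoint_family_on_def)
    have split: "prod (?f (u(y := s))) J = (1 - s * prod u (E j - {y})) * prod (?f u) (J - {j})"
      for s
    proof -
      have "prod (u(y := s)) (E j) = s * prod (u(y := s)) (E j - {y})"
        using prod.remove[OF fin[OF j(1)] j(2), of "u(y := s)"] by simp
      also have "prod (u(y := s)) (E j - {y}) = prod u (E j - {y})"
        by (rule prod.cong) auto
      finally have "?f (u(y := s)) j = 1 - s * prod u (E j - {y})" by simp
      moreover have "prod (?f (u(y := s))) (J - {j}) = prod (?f u) (J - {j})"
        by (intro prod.cong refl same others)
      ultimately show ?thesis
        using prod.remove[OF J j(1), of "?f (u(y := s))"] by simp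
    qed
    show ?thesis unfolding split by (simp add: algebra_simps)
  qed
qed

text \<open>Coordinates are rounded one at a time: an affine function on \<open>[0,1]\<close> is minimal at an end
  point.\<close>
lemma multiaffine_vertex_le:
  assumes "finite Y" and "multiaffine_on Y F" and "\<And>y. y \<in> Y \<Longrightarrow> 0 \<le> u y \<and> u y \<le> 1"
  shows "\<exists>v. (\<forall>y\<in>Y. v y \<in> {0, 1}) \<and> (\<forall>y. y \<notin> Y \<longrightarrow> v y = u y) \<and> F v \<le> F u"
  using assms
proof (induction Y arbitrary: u rule: finite_induct)
  case empty
  then show ?case by auto
next
  case (insert a Y)
  have "F (u(a := u a)) = (1 - u a) * F (u(a := 0)) + u a * F (u(a := 1))"
    using insert.prems(1) unfolding multiaffine_on_def by blast
  then have eq: "F u = (1 - u a) * F (u(a := 0)) + u a * F (u(a := 1))"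
    by (simp only: fun_upd_triv)
  have ua: "0 \<le> u a" "u a \<le> 1" using insert.prems(2)[of a] by auto
  have "\<exists>b\<in>{0, 1}. F (u(a := b)) \<le> F u"
  proof (rule ccontr)
    assume "\<not> ?thesis"
    then have "F u < F (u(a := 0))" "F u < F (u(a := 1))" by auto
    then have "F u < (1 - u a) * F (u(a := 0)) + u a * F (u(a := 1))"
      using convex_bound_lt[of "- F (u(a := 0))" "- F u" "- F (u(a := 1))" "1 - u a" "u a"] ua
      by simp
    then show False using eq by simp
  qed
  then obtain b where b: "b \<in> {0, 1}" "F (u(a := b)) \<le> F u" by blast
  have "multiaffine_on Y F"
    using insert.prems(1) unfolding multiaffine_on_def by blast
  moreover have "0 \<le> (u(a := b)) y \<and> (u(a := b)) y \<le> 1" if "y \<in> Y" for y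
    using insert.prems(2)[of y] that insert.hyps(2) by auto
  ultimately obtain v where v: "\<forall>y\<in>Y. v y \<in> {0, 1}" "\<forall>y. y \<notin> Y \<longrightarrow> v y = (u(a := b)) y"
    "F v \<le> F (u(a := b))"
    using insert.IH[of "u(a := b)"] by blast
  have "v a = b" using v(2) insert.hyps(2) by simp
  then have "\<forall>y\<in>insert a Y. v y \<in> {0, 1}" using v(1) b(1) by simp
  moreover have "\<forall>y. y \<notin> insert a Y \<longrightarrow> v y = u y" using v(2) by simp
  moreover have "F v \<le> F u" using v(3) b(2) by linarith
  ultimately show ?case by blast
qed

section \<open>Small sets containing a member of each of many disjoint families\<close>

text \<open>The first-moment method: the two summands of \<open>small\<close> are the expected number of indices
  \<open>i\<close> for which a random \<open>U\<close> contains none of the sets \<open>E i j\<close>, and the Markov bound on the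
  probability that \<open>U\<close> has at least \<open>B\<close> elements.\<close>
lemma ex_small_transversal_set:
  fixes E :: "'i \<Rightarrow> 'j \<Rightarrow> 'a set" and p B :: real
  assumes Y: "finite Y" and I: "finite I" and J: "\<And>i. i \<in> I \<Longrightarrow> finite (J i)"
    and sub: "\<And>i j. i \<in> I \<Longrightarrow> j \<in> J i \<Longrightarrow> E i j \<subseteq> Y"
    and cardE: "\<And>i j. i \<in> I \<Longrightarrow> j \<in> J i \<Longrightarrow> card (E i j) = k"
    and disj: "\<And>i. i \<in> I \<Longrightarrow> disjoint_family_on (E i) (J i)"
    and p: "0 \<le> p" "p \<le> 1" and B: "0 < B"
    and small: "(\<Sum>i\<in>I. (1 - p ^ k) ^ card (J i)) + real (card Y) * p / B < 1"
  shows "\<exists>U\<subseteq>Y. (\<forall>i\<in>I. \<exists>j\<in>J i. E i j \<subseteq> U) \<and> real (card U) < B"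
proof -
  define miss where "miss i u = (\<Prod>j\<in>J i. 1 - (\<Prod>y\<in>E i j. u y))" for i and u :: "'a \<Rightarrow> real"
  define F where "F u = (\<Sum>i\<in>I. miss i u) + (\<Sum>y\<in>Y. u y) / B" for u :: "'a \<Rightarrow> real"
  have finE: "finite (E i j)" if "i \<in> I" "j \<in> J i" for i j
    using finite_subset[OF sub Y] that by blast
  have "multiaffine_on Y (miss i)" if "i \<in> I" for i
    using multiaffine_on_avoidance[OF J finE disj] that unfolding miss_def by blast
  then have "multiaffine_on Y F"
    unfolding F_def
    by (intro multiaffine_on_add multiaffine_on_sum multiaffine_on_divide
        multiaffine_on_coordinate I Y)
  then obtain v where v: "\<forall>y\<in>Y. v y \<in> {0, 1}" and le: "F v \<le> F (\<lambda>_. p)"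
    using multiaffine_vertex_le[OF Y, of F "\<lambda>_. p"] p by auto
  have "F (\<lambda>_. p) < 1"
    using small cardE by (simp add: F_def miss_def)
  with le have Fv: "F v < 1" by linarith
  define U where "U = {y\<in>Y. v y = 1}"
  have prodv: "(\<Prod>y\<in>E i j. v y) = of_bool (E i j \<subseteq> U)" if "i \<in> I" "j \<in> J i" for i j
  proof (cases "E i j \<subseteq> U")
    case True
    then show ?thesis by (auto simp: U_def intro!: prod.neutral)
  next
    case False
    then show ?thesis
      using v sub[OF that] finE[OF that] by (auto simp: U_def intro!: prod_zero)
  qed
  have missv: "miss i v = of_bool (\<forall>j\<in>J i. \<not> E i j \<subseteq> U)" if "i \<in> I" for i
  proof -
    have "miss i v = (\<Prod>j\<in>J i. of_bool (\<not> E i j \<subseteq> U))"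
      unfolding miss_def using that by (intro prod.cong) (auto simp: prodv)
    also have "\<dots> = of_bool (\<forall>j\<in>J i. \<not> E i j \<subseteq> U)"
      using J[OF that] by (auto intro!: prod_zero prod.neutral)
    finally show ?thesis .
  qed
  have "(\<Sum>y\<in>Y. v y) = (\<Sum>y\<in>Y. of_bool (y \<in> U))"
    using v by (intro sum.cong) (auto simp: U_def)
  also have "\<dots> = real (card U)"
    using Y by (simp add: U_def sum.If_cases of_bool_def Int_def)
  finally have sumv: "(\<Sum>y\<in>Y. v y) = real (card U)" .
  have miss_nonneg: "0 \<le> miss i v" if "i \<in> I" for i
    using missv[OF that] by simp
  have "(\<Sum>i\<in>I. miss i v) + real (card U) / B < 1"
    using Fv by (simp add: F_def sumv)
  moreover have "0 \<le> real (card U) / B" using B by simp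
  moreover have "0 \<le> (\<Sum>i\<in>I. miss i v)" by (intro sum_nonneg miss_nonneg)
  ultimately have few: "(\<Sum>i\<in>I. miss i v) < 1" and "real (card U) / B < 1" by linarith+
  then have "real (card U) < B" using B by (simp add: field_simps)
  moreover have "\<exists>j\<in>J i. E i j \<subseteq> U" if i: "i \<in> I" for i
  proof (rule ccontr)
    assume "\<not> ?thesis"
    then have "miss i v = 1" using missv[OF i] by simp
    moreover have "miss i v \<le> (\<Sum>i\<in>I. miss i v)"
      using i I miss_nonneg by (intro member_le_sum) auto
    ultimately show False using few by simp
  qed
  ultimately show ?thesis by (intro exI[of _ U]) (auto simp: U_def)
qed

section \<open>Disjoint translates\<close>

text \<open>A maximal \<open>D\<close> with disjoint translates works: every \<open>x\<close> in \<open>X\<close> has a translate that meets one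
  of those of \<open>D\<close>, so \<open>X\<close> is covered by the elements \<open>g a b\<inverse>\<close> with \<open>g\<close> in \<open>D\<close> and \<open>a\<close>, \<open>b\<close> in \<open>W\<close>.\<close>
lemma (in group) ex_many_disjoint_translates:
  assumes X: "X \<subseteq> carrier G" "finite X" and W: "W \<subseteq> carrier G" "finite W" "W \<noteq> {}"
  shows "\<exists>D\<subseteq>X. disjoint_family_on (\<lambda>g. g <# W) D \<and> card X \<le> card D * (card W)\<^sup>2"
proof -
  define P where "P = {D. D \<subseteq> X \<and> disjoint_family_on (\<lambda>g. g <# W) D}"
  have "finite P" using X(2) by (simp add: P_def)
  moreover have "{} \<in> P" by (simp add: P_def disjoint_family_on_def)
  then have "P \<noteq> {}" by auto
  ultimately have "\<exists>D\<in>P. \<forall>D'\<in>P. D \<subseteq> D' \<longrightarrow> D = D'"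
    by (rule finite_has_maximal)
  then obtain D where D: "D \<in> P" and max: "\<And>D'. D' \<in> P \<Longrightarrow> D \<subseteq> D' \<Longrightarrow> D = D'"
    by blast
  have DX: "D \<subseteq> X" and disj: "disjoint_family_on (\<lambda>g. g <# W) D" using D by (auto simp: P_def)
  have finD: "finite D" using DX X(2) finite_subset by blast
  let ?f = "\<lambda>(g, a, b). g \<otimes> a \<otimes> inv b"
  have "X \<subseteq> ?f ` (D \<times> W \<times> W)"
  proof
    fix x assume x: "x \<in> X"
    have "\<exists>g\<in>D. \<exists>a\<in>W. \<exists>b\<in>W. g \<otimes> a = x \<otimes> b"
    proof (cases "x \<in> D")
      case True
      then show ?thesis using W(3) by blast
    next
      case False
      then have "insert x D \<notin> P" using max[of "insert x D"] by blast
      then have "\<not> disjoint_family_on (\<lambda>g. g <# W) (insert x D)"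
        using DX x by (simp add: P_def)
      then have "\<exists>g\<in>D. (x <# W) \<inter> (g <# W) \<noteq> {}"
        using disj False by (auto simp: disjoint_family_on_insert)
      then show ?thesis by (fastforce simp: l_coset_def)
    qed
    then obtain g a b where gab: "g \<in> D" "a \<in> W" "b \<in> W" "g \<otimes> a = x \<otimes> b" by blast
    have "x \<in> carrier G" "b \<in> carrier G" using x gab X(1) W(1) by auto
    then have "x = g \<otimes> a \<otimes> inv b" using gab(4) by (simp add: m_assoc)
    then show "x \<in> ?f ` (D \<times> W \<times> W)" using gab by (intro image_eqI[of _ _ "(g, a, b)"]) auto
  qed
  then have "card X \<le> card (?f ` (D \<times> W \<times> W))" using finD W(2) by (intro card_mono) auto
  also have "\<dots> \<le> card (D \<times> W \<times> W)" using finD W(2) by (intro card_image_le) auto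
  also have "\<dots> = card D * (card W)\<^sup>2" by (simp add: card_cartesian_product power2_eq_square)
  finally show ?thesis using DX disj by blast
qed

lemma (in group) card_l_coset:
  assumes "g \<in> carrier G" and "W \<subseteq> carrier G"
  shows "card (g <# W) = card W"
proof -
  have "g <# W = (\<lambda>h. g \<otimes> h) ` W" by (auto simp: l_coset_def)
  then show ?thesis
    using card_image[OF inj_on_subset[OF inj_on_cmult[OF assms(1)] assms(2)]] by simp
qed

section \<open>Small universal sets\<close>

lemma two_mult_cube_le_four_power: "2 \<le> k \<Longrightarrow> 2 * k ^ 3 \<le> (4::nat) ^ k"
proof (induction k rule: nat_induct_at_least)
  case base
  then show ?case by simp
next
  case (Suc k)
  \<comment> \<open>\<open>(1 + 1 / k)\<^sup>3 \<le> 27 / 8 < 4\<close> for \<open>k \<ge> 2\<close>\<close>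
  obtain m where m: "k = m + 2" using Suc.hyps by (metis add.commute le_Suc_ex)
  have "2 * Suc k ^ 3 \<le> 4 * (2 * k ^ 3)"
    unfolding m by (simp add: power3_eq_cube algebra_simps)
  then show ?case using Suc.IH by simp
qed

lemma universal_for_empty: "finite X \<Longrightarrow> card X < k \<Longrightarrow> universal_for G k X {}"
  by (auto simp: universal_for_def dest: card_mono)

text \<open>The choice of \<open>p\<close> makes the failure probability at most \<open>n powr (- 2 k)\<close> for a single \<open>W\<close>. If
  this \<open>p\<close> exceeds 1 it is no probability, but then \<open>X X\<close> itself has at most \<open>3 n \<le> 9 n p\<close> elements.\<close>
lemma (in group) ex_small_universal_for:
  assumes fin: "finite (carrier G)" and k: "k \<ge> 2" and X: "X \<subseteq> carrier G"
    and doubling: "card (X <#> X) \<le> 3 * card X" and X1: "card X > 1"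
  shows "\<exists>U\<subseteq>carrier G. universal_for G k X U \<and>
      real (card U) \<le> 36 * real (card X) powr (1 - 1 / real k)
                         * ln (real (card X)) powr (1 / real k)"
proof -
  define n where "n = real (card X)"
  define p where "p = (2 * real k ^ 3 * ln n / n) powr (1 / real k)"
  define B where "B = 36 * n powr (1 - 1 / real k) * ln n powr (1 / real k)"
  have n: "n \<ge> 2" using X1 by (simp add: n_def)
  then have ln: "ln n > 0" by simp
  have finX: "finite X" using X fin finite_subset by blast
  have X_ne: "X \<noteq> {}" using X1 by auto
  have XX: "X <#> X \<subseteq> carrier G" by (rule set_mult_closed[OF X X])
  have translate: "g <# W \<subseteq> X <#> X" if "g \<in> X" "W \<subseteq> X" for g W
    using that by (auto simp: l_coset_def set_mult_def)
  have p_pos: "p > 0" using k n ln by (simp add: p_def)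
  have p_pow: "p ^ k = 2 * real k ^ 3 * ln n / n"
  proof -
    have "p ^ k = p powr real k" using p_pos by (simp add: powr_realpow)
    also have "\<dots> = 2 * real k ^ 3 * ln n / n"
      using k n ln by (simp add: p_def powr_powr)
    finally show ?thesis .
  qed
  have p_le: "9 * (n * p) \<le> B"
  proof -
    have "real (2 * k ^ 3) \<le> real (4 ^ k)"
      using two_mult_cube_le_four_power[OF k] by (simp only: of_nat_le_iff)
    then have "(2 * real k ^ 3) powr (1 / real k) \<le> (4 ^ k) powr (1 / real k)"
      by (intro powr_mono2) auto
    also have "\<dots> = (4::real)" using k by (simp add: powr_realpow[symmetric] powr_powr)
    finally have root: "(2 * real k ^ 3) powr (1 / real k) \<le> 4" .
    have "n * p = (2 * real k ^ 3) powr (1 / real k)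
        * (n powr (1 - 1 / real k) * ln n powr (1 / real k))"
      using n ln by (simp add: p_def powr_mult powr_divide powr_diff)
    also have "\<dots> \<le> 4 * (n powr (1 - 1 / real k) * ln n powr (1 / real k))"
      using root by (intro mult_right_mono) auto
    finally show ?thesis by (simp add: B_def mult_ac)
  qed
  have "\<exists>U\<subseteq>carrier G. universal_for G k X U \<and> real (card U) \<le> B"
  proof (cases "p \<le> 1")
    case False
    have "real (card (X <#> X)) \<le> 3 * n" using doubling by (simp add: n_def)
    also have "\<dots> \<le> 9 * (n * p)" using n False by (simp add: mult_le_cancel_left1)
    also have "\<dots> \<le> B" by (rule p_le)
    finally have "real (card (X <#> X)) \<le> B" .
    moreover have "universal_for G k X (X <#> X)"
      unfolding universal_for_def using translate X_ne X by blast
    ultimately show ?thesis using XX by blast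
  next
    case True
    define I where "I = {W. W \<subseteq> X \<and> card W = k}"
    have "\<exists>D\<subseteq>X. disjoint_family_on (\<lambda>g. g <# W) D \<and> card X \<le> card D * k\<^sup>2" if "W \<in> I" for W
    proof -
      have "W \<subseteq> carrier G" "finite W" "W \<noteq> {}" "card W = k"
        using that X k finX by (auto simp: I_def intro: finite_subset)
      then show ?thesis using ex_many_disjoint_translates[OF X finX, of W] by simp
    qed
    then obtain D where D: "\<And>W. W \<in> I \<Longrightarrow> D W \<subseteq> X"
      "\<And>W. W \<in> I \<Longrightarrow> disjoint_family_on (\<lambda>g. g <# W) (D W)"
      "\<And>W. W \<in> I \<Longrightarrow> card X \<le> card (D W) * k\<^sup>2"
      by metis
    have fail: "(1 - p ^ k) ^ card (D W) \<le> (1 / n ^ k)\<^sup>2" if W: "W \<in> I" for W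
    proof -
      let ?m = "card (D W)"
      have "(1 - p ^ k) ^ ?m \<le> exp (- (p ^ k)) ^ ?m"
        using p_pos True exp_ge_add_one_self[of "- (p ^ k)"]
        by (intro power_mono) (auto intro: power_le_one)
      also have "\<dots> = exp (- (real ?m * p ^ k))" by (simp add: exp_of_nat_mult[symmetric])
      also have "\<dots> \<le> exp (- (2 * (real k * ln n)))"
      proof -
        have "n \<le> real (?m * k\<^sup>2)" unfolding n_def using D(3)[OF W] by (simp only: of_nat_le_iff)
        then have "1 \<le> real ?m * real k ^ 2 / n" using n by simp
        then have "2 * (real k * ln n) * 1 \<le> 2 * (real k * ln n) * (real ?m * real k ^ 2 / n)"
          using ln by (intro mult_left_mono) auto
        also have "\<dots> = real ?m * p ^ k"
          by (simp add: p_pow power2_eq_square power3_eq_cube)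
        finally show ?thesis by simp
      qed
      also have "\<dots> = inverse (exp (real k * ln n) ^ 2)"
        by (simp add: exp_minus exp_double)
      also have "\<dots> = (1 / n ^ k)\<^sup>2"
        using n by (simp add: exp_of_nat_mult power_one_over inverse_eq_divide)
      finally show ?thesis .
    qed
    have finI: "finite I" using finX by (auto simp: I_def intro: finite_subset[of _ "Pow X"])
    have "real (card I) = real (card X choose k)"
      using n_subsets[OF finX, of k] by (simp add: I_def)
    also have "\<dots> \<le> n ^ k"
    proof (cases "k \<le> card X")
      case True
      then show ?thesis
        using binomial_le_pow[OF True] unfolding n_def
        by (metis of_nat_le_iff of_nat_power)
    next
      case False
      then show ?thesis using n by (simp add: binomial_eq_0)
    qed
    finally have cardI: "real (card I) \<le> n ^ k" .
    have "(\<Sum>W\<in>I. (1 - p ^ k) ^ card (D W)) \<le> real (card I) * (1 / n ^ k)\<^sup>2"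
      by (rule sum_bounded_above[OF fail])
    also have "\<dots> \<le> n ^ k * (1 / n ^ k)\<^sup>2" using cardI by (intro mult_right_mono) auto
    also have "\<dots> = 1 / n ^ k" using n by (simp add: power2_eq_square)
    also have "\<dots> \<le> 1 / 4"
    proof -
      have "(4::real) = 2 ^ 2" by simp
      also have "\<dots> \<le> n ^ 2" using n by (intro power_mono) auto
      also have "\<dots> \<le> n ^ k" using n k by (intro power_increasing) auto
      finally show ?thesis by (simp add: field_simps)
    qed
    finally have failures: "(\<Sum>W\<in>I. (1 - p ^ k) ^ card (D W)) \<le> 1 / 4" .
    have B_pos: "0 < 9 * (n * p)" using n p_pos by simp
    have "real (card (X <#> X)) * p \<le> 3 * n * p"
      using doubling p_pos by (intro mult_right_mono) (auto simp: n_def)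
    then have "real (card (X <#> X)) * p / (9 * (n * p)) \<le> 1 / 3"
      unfolding pos_divide_le_eq[OF B_pos] by linarith
    with failures have small: "(\<Sum>W\<in>I. (1 - p ^ k) ^ card (D W))
        + real (card (X <#> X)) * p / (9 * (n * p)) < 1"
      by linarith
    have "\<exists>U\<subseteq>X <#> X. (\<forall>W\<in>I. \<exists>g\<in>D W. g <# W \<subseteq> U) \<and> real (card U) < 9 * (n * p)"
    proof (rule ex_small_transversal_set[OF _ finI _ _ _ D(2) _ True B_pos small])
      show "finite (X <#> X)" using XX fin finite_subset by blast
      show "finite (D W)" if "W \<in> I" for W using D(1)[OF that] finX finite_subset by blast
      show "g <# W \<subseteq> X <#> X" if "W \<in> I" "g \<in> D W" for W g
        using translate D(1) that by (auto simp: I_def)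
      show "card (g <# W) = k" if "W \<in> I" "g \<in> D W" for W g
      proof -
        have "g \<in> carrier G" "W \<subseteq> carrier G" using D(1) X that by (auto simp: I_def)
        then show ?thesis using card_l_coset that by (simp add: I_def)
      qed
      show "0 \<le> p" using p_pos by simp
    qed
    then obtain U where U: "U \<subseteq> X <#> X" "\<forall>W\<in>I. \<exists>g\<in>D W. g <# W \<subseteq> U"
      "real (card U) < 9 * (n * p)" by blast
    have "universal_for G k X U"
      unfolding universal_for_def
    proof (intro allI impI)
      fix W assume "W \<subseteq> X \<and> finite W \<and> card W = k"
      then have W: "W \<in> I" by (simp add: I_def)
      then obtain g where g: "g \<in> D W" "g <# W \<subseteq> U" using U(2) by blast
      have "g \<in> carrier G" using g(1) D(1)[OF W] X by blast
      then show "\<exists>g\<in>carrier G. g <# W \<subseteq> U" using g(2) by (rule bexI[rotated])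
    qed
    moreover have "real (card U) \<le> B" using U(3) p_le by linarith
    ultimately show ?thesis using U(1) XX by blast
  qed
  then show ?thesis by (simp add: B_def n_def)
qed

theorem theorem1p2:
  fixes G :: "('a, 'b) monoid_scheme" and k :: nat
  assumes "k \<ge> 2" and "group G" and "finite (carrier G)"
  shows "(\<forall>X \<subseteq> carrier G. non_doubling G X \<and> card X > 1 \<longrightarrow>
            (\<exists>U \<subseteq> carrier G. universal_for G k X U \<and>
               real (card U) \<le> 36 * real (card X) powr (1 - 1 / real k)
                                 * ln (real (card X)) powr (1 / real k)))
       \<and> (\<exists>U \<subseteq> carrier G. universal G k U \<and>
            real (card U) \<le> 36 * real (order G) powr (1 - 1 / real k)
                              * ln (real (order G)) powr (1 / real k))"
proof -
  interpret group G by (rule assms(2))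
  have main: "\<exists>U\<subseteq>carrier G. universal_for G k X U \<and>
      real (card U) \<le> 36 * real (card X) powr (1 - 1 / real k)
                         * ln (real (card X)) powr (1 / real k)"
    if "X \<subseteq> carrier G" "non_doubling G X" "card X > 1" for X
    using ex_small_universal_for[OF assms(3,1) that(1) _ that(3)] that(2)
    by (simp add: non_doubling_def)
  moreover have "\<exists>U\<subseteq>carrier G. universal G k U \<and>
      real (card U) \<le> 36 * real (order G) powr (1 - 1 / real k)
                        * ln (real (order G)) powr (1 / real k)"
  proof (cases "order G > 1")
    case True
    have "carrier G <#>\<^bsub>G\<^esub> carrier G \<subseteq> carrier G" by (rule set_mult_closed) auto
    then have "card (carrier G <#>\<^bsub>G\<^esub> carrier G) \<le> card (carrier G)"
      by (rule card_mono[OF assms(3)])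
    then have "non_doubling G (carrier G)" by (simp add: non_doubling_def)
    then show ?thesis
      using main[of "carrier G"] True by (simp add: universal_def order_def)
  next
    case False
    \<comment> \<open>For the trivial group the bound is 0, and there are no \<open>k\<close>-element sets.\<close>
    then have "universal G k {}"
      using assms(1,3) unfolding universal_def order_def
      by (intro universal_for_empty) auto
    then show ?thesis by (intro exI[of _ "{}"]) simp
  qed
  ultimately show ?thesis by blast
qed

end
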